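(* Let $G$ be a $d$-regular graph, $d\geq 7$, with no cycle of length $4$. Then $f(G)\geq \left\lceil\frac{d-1}{2}\right\rceil+2$.
   Context: Graphs are finite and simple. Having no cycle of length $4$ means having no such cycle as a (not necessarily induced) subgraph. In a proper vertex coloring of a graph, a vertex of color $i$ is called dominant if it has a neighbor in each color class distinct from $i$ (that is, a neighbor of every available color other than its own). For a $d$-regular graph $G$, the $f$-chromatic vertex number $f(G)$ is the maximum number of dominant vertices of pairwise distinct colors in a proper coloring of $G$ with $d+1$ colors. *)

theory Defs
  imports Complex_Main "Graph_Theory.Pair_Digraph"
begin

text \<open>
  Finite simple graphs are the instances of the locale \<^locale>\<open>pair_graph\<close>: finite, loop-free,
  symmetric digraphs without parallel arcs. An edge between \<open>u\<close> and \<open>v\<close> is represented by the two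
  arcs \<open>(u, v)\<close> and \<open>(v, u)\<close>, so the degree of a vertex is its out-degree.
\<close>

definition regular_graph :: "'a pair_pre_digraph \<Rightarrow> nat \<Rightarrow> bool" where
  "regular_graph G d \<longleftrightarrow> pair_graph G \<and> (\<forall>v \<in> pverts G. out_degree (with_proj G) v = d)"

text \<open>
  The library's \<open>cycle\<close> also admits \<open>u, v, u\<close> in a symmetric digraph, but this has length 2; at
  length 4 its four vertices are distinct, and chords are allowed.
\<close>

definition C4_free :: "'a pair_pre_digraph \<Rightarrow> bool" where
  "C4_free G \<longleftrightarrow> \<not> (\<exists>p. pre_digraph.cycle (with_proj G) p \<and> length p = 4)"

text \<open>The available colors are \<open>1, \<dots>, k\<close>; they need not all be used.\<close>

definition proper_coloring :: "'a pair_pre_digraph \<Rightarrow> nat \<Rightarrow> ('a \<Rightarrow> nat) \<Rightarrow> bool" where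
  "proper_coloring G k c \<longleftrightarrow>
     (\<forall>v \<in> pverts G. c v \<in> {1..k}) \<and> (\<forall>(u, v) \<in> parcs G. c u \<noteq> c v)"

definition dominant :: "'a pair_pre_digraph \<Rightarrow> nat \<Rightarrow> ('a \<Rightarrow> nat) \<Rightarrow> 'a \<Rightarrow> bool" where
  "dominant G k c v \<longleftrightarrow>
     v \<in> pverts G \<and> (\<forall>i \<in> {1..k} - {c v}. \<exists>u. (v, u) \<in> parcs G \<and> c u = i)"

text \<open>
  The maximum ranges over both the coloring and the set of dominant vertices. For a \<open>d\<close>-regular
  graph it is taken over a finite nonempty set of numbers, as a proper coloring with \<open>d + 1\<close>
  colors exists by the greedy algorithm. The degree \<open>d\<close> is an argument; it is determined by a
  nonempty regular graph.
\<close>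

definition f_chromatic_vertex_number :: "'a pair_pre_digraph \<Rightarrow> nat \<Rightarrow> nat" where
  "f_chromatic_vertex_number G d =
     Max {card S | c S. proper_coloring G (d + 1) c \<and>
                        S \<subseteq> {v. dominant G (d + 1) c v} \<and> inj_on c S}"

end

theory Submission
  imports Defs
begin

text \<open>
  Root the graph at any vertex \<open>v\<close>, give \<open>v\<close> the colour \<open>d + 1\<close> and its neighbours
  \<open>e 1, \<dots>, e d\<close> the colours \<open>1, \<dots>, d\<close>; then \<open>v\<close> is dominant. The idea is to make \<open>d div 2 + 1\<close> of
  the \<open>e i\<close> dominant as well, which is the required number since
  \<open>\<lceil>(d - 1) / 2\<rceil> = d div 2\<close>. Each \<open>e i\<close> sees \<open>v\<close>, at most one other \<open>e j\<close> (there is no 4-cycle),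
  and the rest of its neighbours form its petal, of exactly the size of the set of colours still
  missing around \<open>e i\<close>, its palette. So \<open>e i\<close> becomes dominant once its petal is coloured
  bijectively with its palette. What remains of the graph is then coloured greedily with \<open>d + 1\<close>
  colours.

  The petals are filled one after the other. As there is no 4-cycle, petals are disjoint and a vertex
  outside a petal and not equal to its centre has at most one neighbour in it. Hence, with \<open>p\<close>
  petals filled, every vertex of the next petal is denied at most \<open>p\<close> colours and every colour
  is denied to at most \<open>p\<close> vertices. By Hall's theorem the next petal, of size \<open>n\<close>, can be filled
  whenever \<open>2 p \<le> n\<close> (\<open>bij_avoiding_sparse\<close>). This settles \<open>d div 2\<close> petals
  (\<open>fills_half\<close>). It settles one more if two of the neighbours of \<open>v\<close> are adjacent: no edge joins
  their two petals, so one of these petals does not count when the other is filled last. It also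
  settles one more if \<open>d\<close> is odd and the neighbours of \<open>v\<close> are independent.

  There remains the case that \<open>d = 2 m\<close> and that the neighbours of \<open>v\<close> are independent, where
  \<open>p = m\<close> and \<open>n = 2 m - 1\<close> miss Hall's condition by one. Failure is then very rigid
  (\<open>critical_obstruction\<close>): there are \<open>m\<close> vertices in the last petal that are all denied the
  same \<open>m\<close> colours. These sets are essentially determined by all but one of the filled petals,
  and the obstruction then prescribes the colours in the remaining filled petal of the neighbours of
  these vertices. But that petal was filled with room to spare, so one of these colours can be
  changed, and after this change the last petal can be filled
  (\<open>fills_extend_after_recolouring\<close>).
\<close>

section \<open>Bijections that avoid a relation\<close>

text \<open>
  Hall's marriage theorem, by the argument of Halmos and Vaughan. If some proper nonempty \<open>A\<close> is
  tight, then \<open>A\<close> and its complement can be matched independently of each other; if none is, then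
  any one element can be matched to any of its values without violating Hall's condition for the others.
\<close>

lemma hall_distinct_representatives:
  fixes S :: "'a \<Rightarrow> 'b set"
  assumes "finite X" "\<And>x. x \<in> X \<Longrightarrow> finite (S x)"
    and "\<And>A. A \<subseteq> X \<Longrightarrow> card A \<le> card (\<Union>x\<in>A. S x)"
  shows "\<exists>f. inj_on f X \<and> (\<forall>x\<in>X. f x \<in> S x)"
  using assms
proof (induction X arbitrary: S rule: finite_psubset_induct)
  case (psubset X)
  note fin = psubset.prems(1) and hall = psubset.prems(2)
  have finN: "finite (\<Union>x\<in>A. S x)" if "A \<subseteq> X" for A
    using that fin psubset.hyps by (meson finite_UN_I finite_subset subsetD)
  consider "X = {}"
    | A where "A \<subset> X" "A \<noteq> {}" "card (\<Union>x\<in>A. S x) = card A"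
    | x where "x \<in> X" "\<And>A. A \<subset> X \<Longrightarrow> A \<noteq> {} \<Longrightarrow> card A < card (\<Union>x\<in>A. S x)"
    by (metis all_not_in_conv hall order_le_less psubset_imp_subset)
  then show ?case
  proof cases
    case 1
    then show ?thesis by simp
  next
    case (2 A)
    let ?N = "\<Union>x\<in>A. S x"
    have "\<exists>f. inj_on f A \<and> (\<forall>x\<in>A. f x \<in> S x)"
      using 2 by (intro psubset.IH[OF 2(1)]) (use fin hall in \<open>blast, meson psubset_imp_subset subset_trans\<close>)
    then obtain f where f: "inj_on f A" "\<And>x. x \<in> A \<Longrightarrow> f x \<in> S x"
      by blast
    have "\<exists>g. inj_on g (X - A) \<and> (\<forall>x\<in>X - A. g x \<in> S x - ?N)"
    proof (intro psubset.IH)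
      show "X - A \<subset> X" using 2 by blast
      show "finite (S x - ?N)" if "x \<in> X - A" for x using that fin by blast
      show "card B \<le> card (\<Union>x\<in>B. S x - ?N)" if B: "B \<subseteq> X - A" for B
      proof -
        have fB: "finite A" "finite B"
          using B 2 psubset.hyps by (auto intro: finite_subset)
        have "card A + card B = card (A \<union> B)"
          using B fB by (subst card_Un_disjoint) auto
        also have "\<dots> \<le> card (\<Union>x\<in>A \<union> B. S x)"
          using B 2 by (intro hall) auto
        also have "(\<Union>x\<in>A \<union> B. S x) = ?N \<union> (\<Union>x\<in>B. S x - ?N)"
          by blast
        also have "card \<dots> \<le> card ?N + card (\<Union>x\<in>B. S x - ?N)"
          by (rule card_Un_le)
        finally show ?thesis using 2 by simp
      qed
    qed
    then obtain g where g: "inj_on g (X - A)" "\<And>x. x \<in> X - A \<Longrightarrow> g x \<in> S x - ?N"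
      by blast
    let ?h = "\<lambda>x. if x \<in> A then f x else g x"
    have "inj_on ?h X"
      using f g unfolding inj_on_def by (smt (verit) DiffD2 DiffI UN_I)
    moreover have "\<forall>x\<in>X. ?h x \<in> S x" using f g by auto
    ultimately show ?thesis by blast
  next
    case (3 x)
    have "card {x} \<le> card (\<Union>z\<in>{x}. S z)" using 3 by (intro hall) auto
    then obtain y where y: "y \<in> S x" by fastforce
    have "\<exists>g. inj_on g (X - {x}) \<and> (\<forall>z\<in>X - {x}. g z \<in> S z - {y})"
    proof (intro psubset.IH)
      show "X - {x} \<subset> X" using 3 by blast
      show "finite (S z - {y})" if "z \<in> X - {x}" for z using that fin by blast
      show "card B \<le> card (\<Union>z\<in>B. S z - {y})" if B: "B \<subseteq> X - {x}" for B
      proof (cases "B = {}")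
        case False
        have "(\<Union>z\<in>B. S z - {y}) = (\<Union>z\<in>B. S z) - {y}" by blast
        moreover have "card B < card (\<Union>z\<in>B. S z)" using 3 B False by blast
        ultimately show ?thesis
          by (auto simp: card_Diff_singleton_if)
      qed simp
    qed
    then obtain g where g: "inj_on g (X - {x})" "\<And>z. z \<in> X - {x} \<Longrightarrow> g z \<in> S z - {y}"
      by blast
    have "inj_on (g(x := y)) X"
      using g unfolding inj_on_def by (auto dest: bspec)
    moreover have "\<forall>z\<in>X. (g(x := y)) z \<in> S z" using g y by auto
    ultimately show ?thesis by blast
  qed
qed

text \<open>
  Hall's theorem for a square 0-1 matrix, in the symmetric form of Frobenius and Koenig: if a
  transversal avoiding \<open>R\<close> is missing, then \<open>R\<close> contains a full block \<open>A \<times> C\<close> that is too large.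
  The block is made of a set \<open>A\<close> violating Hall's condition and of the complement of its
  neighbourhood. In this form the bounds on rows and columns apply to the two sides of the block
  directly.
\<close>

lemma frobenius_koenig:
  fixes R :: "'a \<Rightarrow> 'b \<Rightarrow> bool"
  assumes "finite X" "finite Y" "card X = card Y"
    and no: "\<nexists>f. bij_betw f X Y \<and> (\<forall>x\<in>X. \<not> R x (f x))"
  obtains A C where "A \<subseteq> X" "C \<subseteq> Y" "\<And>x y. x \<in> A \<Longrightarrow> y \<in> C \<Longrightarrow> R x y"
    "card X < card A + card C"
proof -
  let ?S = "\<lambda>x. {y\<in>Y. \<not> R x y}"
  have "\<exists>A\<subseteq>X. card (\<Union>x\<in>A. ?S x) < card A"
  proof (rule ccontr)
    assume "\<not> ?thesis"
    then obtain f where f: "inj_on f X" "\<forall>x\<in>X. f x \<in> ?S x"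
      using hall_distinct_representatives[of X ?S] assms(1,2)
      by (force simp: not_less)
    then have "f ` X = Y"
      using assms by (intro card_subset_eq) (auto simp: card_image)
    then show False using f no by (auto simp: bij_betw_def)
  qed
  then obtain A where A: "A \<subseteq> X" "card (\<Union>x\<in>A. ?S x) < card A" by blast
  let ?N = "\<Union>x\<in>A. ?S x"
  have "card (Y - ?N) = card Y - card ?N" "card ?N \<le> card Y"
    using assms(2) by (auto intro!: card_Diff_subset card_mono intro: finite_subset[of _ Y])
  then have "card X < card A + card (Y - ?N)" using A assms(3) by linarith
  then show thesis using A(1) by (intro that[of A "Y - ?N"]) auto
qed

text \<open>
  A block \<open>A \<times> C\<close> inside \<open>R\<close> has at most \<open>q\<close> rows and at most \<open>p\<close> columns, so it is not larger
  than Frobenius and Koenig allow.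
\<close>

lemma bij_avoiding_sparse:
  fixes R :: "'a \<Rightarrow> 'b \<Rightarrow> bool"
  assumes "finite X" "finite Y" "card X = card Y"
    and row: "\<And>x. x \<in> X \<Longrightarrow> card {y\<in>Y. R x y} \<le> p"
    and col: "\<And>y. y \<in> Y \<Longrightarrow> card {x\<in>X. R x y} \<le> q"
    and "p + q \<le> card X"
  shows "\<exists>f. bij_betw f X Y \<and> (\<forall>x\<in>X. \<not> R x (f x))"
proof (rule ccontr)
  assume "\<not> ?thesis"
  then obtain A C where AC: "A \<subseteq> X" "C \<subseteq> Y" "\<And>x y. x \<in> A \<Longrightarrow> y \<in> C \<Longrightarrow> R x y"
    "card X < card A + card C"
    using frobenius_koenig[OF assms(1-3)] by metis
  have "card A \<le> card X" "card C \<le> card Y"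
    using card_mono[OF assms(1) AC(1)] card_mono[OF assms(2) AC(2)] by auto
  then obtain x y where xy: "x \<in> A" "y \<in> C"
    using AC(4) assms(3) by (metis add.right_neutral add_0 card.empty equals0I not_less)
  have "card C \<le> card {y\<in>Y. R x y}" "card A \<le> card {x\<in>X. R x y}"
    using AC xy assms by (auto intro!: card_mono)
  moreover have "card {y\<in>Y. R x y} \<le> p" "card {x\<in>X. R x y} \<le> q"
    using row col AC xy by auto
  ultimately show False using AC(4) assms(6) by linarith
qed

text \<open>
  With one unit of room, the value at \<open>x0\<close> can be chosen freely among its admissible values, of
  which there are at least \<open>q + 1\<close>: choose one other than \<open>y0\<close> and apply \<open>bij_avoiding_sparse\<close> to
  what is left.
\<close>

lemma bij_avoiding_sparse_and_value:
  fixes R :: "'a \<Rightarrow> 'b \<Rightarrow> bool"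
  assumes "finite X" "finite Y" "card X = card Y"
    and row: "\<And>x. x \<in> X \<Longrightarrow> card {y\<in>Y. R x y} \<le> p"
    and col: "\<And>y. y \<in> Y \<Longrightarrow> card {x\<in>X. R x y} \<le> q"
    and "p + q < card X" "0 < q" "x0 \<in> X"
  shows "\<exists>f. bij_betw f X Y \<and> (\<forall>x\<in>X. \<not> R x (f x)) \<and> f x0 \<noteq> y0"
proof -
  have "card Y \<le> card (insert y0 {y\<in>Y. R x0 y})" if "Y \<subseteq> insert y0 {y\<in>Y. R x0 y}"
    using that assms(2) by (auto intro: card_mono)
  moreover have "card (insert y0 {y\<in>Y. R x0 y}) \<le> Suc p"
    using row[OF assms(8)] assms(2) by (simp add: card_insert_if)
  ultimately obtain y1 where y1: "y1 \<in> Y" "y1 \<noteq> y0" "\<not> R x0 y1"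
    using assms(3,6,7) by fastforce
  have "\<exists>f. bij_betw f (X - {x0}) (Y - {y1}) \<and> (\<forall>x\<in>X - {x0}. \<not> R x (f x))"
  proof (rule bij_avoiding_sparse)
    show "card {y \<in> Y - {y1}. R x y} \<le> p" if "x \<in> X - {x0}" for x
      using that by (intro order_trans[OF card_mono row[of x]]) (use assms in auto)
    show "card {x \<in> X - {x0}. R x y} \<le> q" if "y \<in> Y - {y1}" for y
      using that by (intro order_trans[OF card_mono col[of y]]) (use assms in auto)
  qed (use assms y1 in auto)
  then obtain f where f: "bij_betw f (X - {x0}) (Y - {y1})" "\<forall>x\<in>X - {x0}. \<not> R x (f x)"
    by blast
  have "bij_betw (f(x0 := y1)) (X - {x0}) (Y - {y1})"
    using f(1) by (subst bij_betw_cong[of _ _ f]) auto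
  from notIn_Un_bij_betw[OF _ _ this, of x0]
  have "bij_betw (f(x0 := y1)) (insert x0 (X - {x0})) (insert y1 (Y - {y1}))"
    by simp
  then have "bij_betw (f(x0 := y1)) X Y"
    using assms(8) y1(1) by (simp add: insert_absorb)
  then show ?thesis using f y1 by (intro exI[of _ "f(x0 := y1)"]) auto
qed

text \<open>
  The first case that \<open>bij_avoiding_sparse\<close> does not cover. Now the block of Frobenius and Koenig
  must have the largest size that the bounds on rows and columns admit, so its rows and columns
  contain no further elements of \<open>R\<close>.
\<close>

lemma critical_obstruction:
  fixes R :: "'a \<Rightarrow> 'b \<Rightarrow> bool"
  assumes "finite X" "finite Y" "card X = card Y"
    and row: "\<And>x. x \<in> X \<Longrightarrow> card {y\<in>Y. R x y} \<le> p"
    and col: "\<And>y. y \<in> Y \<Longrightarrow> card {x\<in>X. R x y} \<le> q"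
    and "p + q = Suc (card X)"
    and no: "\<nexists>f. bij_betw f X Y \<and> (\<forall>x\<in>X. \<not> R x (f x))"
  shows "\<exists>A C. A \<subseteq> X \<and> C \<subseteq> Y \<and> card A = q \<and> card C = p \<and>
    (\<forall>x\<in>A. {y\<in>Y. R x y} = C) \<and> (\<forall>y\<in>C. {x\<in>X. R x y} = A)"
proof -
  obtain A C where AC: "A \<subseteq> X" "C \<subseteq> Y" "\<And>x y. x \<in> A \<Longrightarrow> y \<in> C \<Longrightarrow> R x y"
    "card X < card A + card C"
    using frobenius_koenig[OF assms(1-3) no] by metis
  have "card A \<le> card X" "card C \<le> card Y"
    using card_mono[OF assms(1) AC(1)] card_mono[OF assms(2) AC(2)] by auto
  then obtain x y where xy: "x \<in> A" "y \<in> C"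
    using AC(4) assms(3) by (metis add.right_neutral add_0 card.empty equals0I not_less)
  have sub: "C \<subseteq> {y\<in>Y. R x y}" if "x \<in> A" for x using AC that by auto
  have sub': "A \<subseteq> {x\<in>X. R x y}" if "y \<in> C" for y using AC that by auto
  have fin: "finite {y\<in>Y. R x y}" "finite {x\<in>X. R x y}" for x y using assms by auto
  have le: "card C \<le> p" "card A \<le> q"
    using card_mono[OF fin(1) sub[OF xy(1)]] row[of x] card_mono[OF fin(2) sub'[OF xy(2)]] col[of y]
      AC xy by auto
  then have eq: "card C = p" "card A = q" using AC(4) assms(6) by auto
  have "{y\<in>Y. R x y} = C" if "x \<in> A" for x
    using card_seteq[OF fin(1) sub[OF that]] row[of x] that AC(1) eq by auto
  moreover have "{x\<in>X. R x y} = A" if "y \<in> C" for y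
    using card_seteq[OF fin(2) sub'[OF that]] col[of y] that AC(2) eq by auto
  ultimately show ?thesis using AC(1,2) eq by blast
qed

text \<open>
  The form in which the absence of 4-cycles enters the counts of denied colours: every element of
  \<open>B\<close> has a witness in \<open>J\<close>, and a witness serves only one element.
\<close>

lemma card_le_of_private_witness:
  assumes "finite J" "\<And>b. b \<in> B \<Longrightarrow> \<exists>j\<in>J. Q b j"
    and "\<And>b b' j. b \<in> B \<Longrightarrow> b' \<in> B \<Longrightarrow> j \<in> J \<Longrightarrow> Q b j \<Longrightarrow> Q b' j \<Longrightarrow> b = b'"
  shows "card B \<le> card J"
proof -
  obtain g where g: "\<And>b. b \<in> B \<Longrightarrow> g b \<in> J \<and> Q b (g b)" using assms(2) by metis
  then have "inj_on g B" using assms(3) by (metis inj_onI)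
  then show ?thesis using g assms(1) by (intro card_inj_on_le[of g]) auto
qed

section \<open>Petals around a root\<close>

text \<open>
  A \<open>d\<close>-regular graph without 4-cycles, with a root \<open>v\<close> and an enumeration \<open>e\<close> of the neighbours
  of \<open>v\<close>. As \<open>e i\<close> is to receive the colour \<open>i\<close>, the indices are at the same time the colours.
\<close>

locale c4_free_rooted =
  fixes V :: "'a set" and adj :: "'a \<Rightarrow> 'a \<Rightarrow> bool" and d :: nat
    and v :: 'a and e :: "nat \<Rightarrow> 'a"
  assumes finite_V: "finite V"
    and adj_V: "adj u w \<Longrightarrow> w \<in> V"
    and adj_sym: "adj u w \<Longrightarrow> adj w u"
    and adj_irrefl: "\<not> adj u u"
    and degree: "u \<in> V \<Longrightarrow> card {w. adj u w} = d"
    and no_C4: "\<lbrakk>adj u a; adj u b; adj w a; adj w b; u \<noteq> w\<rbrakk> \<Longrightarrow> a = b"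
    and v_V: "v \<in> V"
    and e_bij: "bij_betw e {1..d} {w. adj v w}"
begin

definition petal :: "nat \<Rightarrow> 'a set" where
  "petal i = {x. adj (e i) x \<and> x \<noteq> v \<and> \<not> adj v x}"

text \<open>
  Since there is no 4-cycle, this set has at most one element (\<open>card_partners_le\<close>).
\<close>

definition partners :: "nat \<Rightarrow> nat set" where
  "partners i = {j \<in> {1..d}. adj (e i) (e j)}"

text \<open>
  The colours that \<open>e i\<close> sees neither on itself nor on the root and its neighbours.
\<close>

definition palette :: "nat \<Rightarrow> nat set" where
  "palette i = {1..d} - insert i (partners i)"

text \<open>
  The values of \<open>c\<close> outside the petals with index in \<open>I\<close> are arbitrary, so that a petal can be added
  by changing \<open>c\<close> on this petal only.
\<close>

definition fills :: "nat set \<Rightarrow> ('a \<Rightarrow> nat) \<Rightarrow> bool" where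
  "fills I c \<longleftrightarrow> (\<forall>i\<in>I. bij_betw c (petal i) (palette i)) \<and>
     (\<forall>i\<in>I. \<forall>j\<in>I. \<forall>x\<in>petal i. \<forall>z\<in>petal j. adj x z \<longrightarrow> c x \<noteq> c z)"

definition blocked :: "nat set \<Rightarrow> ('a \<Rightarrow> nat) \<Rightarrow> 'a \<Rightarrow> nat \<Rightarrow> bool" where
  "blocked I c x \<gamma> \<longleftrightarrow> (\<exists>j\<in>I. \<exists>z\<in>petal j. adj x z \<and> c z = \<gamma>)"

lemma adj_e: "i \<in> {1..d} \<Longrightarrow> adj v (e i)"
  using bij_betw_apply[OF e_bij] by simp

lemma e_inj: "i \<in> {1..d} \<Longrightarrow> j \<in> {1..d} \<Longrightarrow> e i = e j \<longleftrightarrow> i = j"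
  using bij_betw_imp_inj_on[OF e_bij] by (simp add: inj_on_eq_iff)

lemma finite_adj: "finite {w. adj u w}"
  by (rule finite_subset[OF _ finite_V]) (use adj_V in blast)

lemma finite_petal: "finite (petal i)"
  by (rule finite_subset[OF _ finite_adj[of "e i"]]) (auto simp: petal_def)

lemma finite_palette: "finite (palette i)"
  by (simp add: palette_def)

lemma card_palette:
  assumes "i \<in> {1..d}"
  shows "card (palette i) = d - Suc (card (partners i))"
proof -
  have "i \<notin> partners i" "finite (partners i)" using adj_irrefl by (auto simp: partners_def)
  then show ?thesis
    unfolding palette_def using assms by (subst card_Diff_subset) (auto simp: partners_def)
qed

text \<open>
  The neighbours of \<open>e i\<close> are the root, the partners and the petal, while the colours \<open>1, \<dots>, d\<close> are
  \<open>i\<close>, the colours of the partners and the palette; so both numbers are \<open>d - 1\<close> minus the number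
  of partners.
\<close>

lemma card_petal:
  assumes "i \<in> {1..d}"
  shows "card (petal i) = card (palette i)"
proof -
  have "{w. adj (e i) w} = insert v (e ` partners i) \<union> petal i"
  proof (intro equalityI subsetI)
    fix x assume "x \<in> {w. adj (e i) w}"
    moreover have "\<exists>j\<in>{1..d}. x = e j" if "adj v x"
      using that bij_betw_imp_surj_on[OF e_bij] by blast
    ultimately show "x \<in> insert v (e ` partners i) \<union> petal i"
      by (auto simp: petal_def partners_def)
  next
    fix x assume "x \<in> insert v (e ` partners i) \<union> petal i"
    then show "x \<in> {w. adj (e i) w}"
      using adj_sym[OF adj_e[OF assms]] by (auto simp: petal_def partners_def)
  qed
  moreover have "card (insert v (e ` partners i) \<union> petal i)
      = card (insert v (e ` partners i)) + card (petal i)"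
    using adj_e finite_petal
    by (intro card_Un_disjoint) (auto simp: petal_def partners_def)
  moreover have "v \<notin> e ` partners i"
    using adj_e adj_irrefl by (fastforce simp: partners_def)
  moreover have "inj_on e (partners i)"
    using e_inj by (auto simp: inj_on_def partners_def)
  moreover have "card {w. adj (e i) w} = d"
    using degree adj_e[OF assms] adj_V by blast
  ultimately show ?thesis
    using card_palette[OF assms] by (auto simp: card_image partners_def)
qed

lemma card_partners_le:
  assumes "i \<in> {1..d}"
  shows "card (partners i) \<le> 1"
proof -
  have "j = k" if "j \<in> partners i" "k \<in> partners i" for j k
    using that no_C4[of "e i" "e j" "e k" v] e_inj[of j k] adj_e adj_irrefl assms
    by (auto simp: partners_def)
  moreover have "finite (partners i)" by (simp add: partners_def)
  ultimately show ?thesis by (simp add: card_le_Suc0_iff_eq)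
qed

lemma petal_disjoint:
  assumes "i \<in> {1..d}" "j \<in> {1..d}" "x \<in> petal i" "x \<in> petal j"
  shows "i = j"
  using assms no_C4[of "e i" x v "e j"] adj_sym adj_e e_inj by (auto simp: petal_def)

lemma unique_neighbour_in_petal:
  assumes "i \<in> {1..d}" "j \<in> {1..d}" "i \<noteq> j" "x \<in> petal i"
    and "z \<in> petal j" "z' \<in> petal j" "adj x z" "adj x z'"
  shows "z = z'"
proof -
  have "x \<noteq> e j" using assms adj_e by (auto simp: petal_def)
  then show ?thesis using assms no_C4[of x z z' "e j"] by (auto simp: petal_def)
qed

text \<open>
  An edge between the petals of two adjacent centres closes a 4-cycle with these centres.
\<close>

lemma no_edge_between_partner_petals:
  assumes "i \<in> {1..d}" "j \<in> partners i" "x \<in> petal i" "z \<in> petal j"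
  shows "\<not> adj x z"
proof
  assume "adj x z"
  moreover have "adj (e i) x" "adj (e i) (e j)" "adj (e j) z" "e i \<noteq> z" "x \<noteq> e j"
    using assms adj_e by (auto simp: petal_def partners_def)
  ultimately show False using no_C4[of "e i" x "e j" z] adj_sym by blast
qed

text \<open>
  A filled petal denies at most one colour to \<open>x\<close>, because \<open>x\<close> has at most one neighbour in it;
  the petal of a partner denies none.
\<close>

lemma colours_blocked_for_vertex:
  assumes "i \<in> {1..d}" "I \<subseteq> {1..d}" "i \<notin> I" "x \<in> petal i"
  shows "card {\<gamma> \<in> palette i. blocked I c x \<gamma>} \<le> card (I - partners i)"
proof (rule card_le_of_private_witness[where Q = "\<lambda>\<gamma> j. \<exists>z\<in>petal j. adj x z \<and> c z = \<gamma>"])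
  show "finite (I - partners i)"
    using \<open>I \<subseteq> {1..d}\<close> finite_subset by blast
  show "\<exists>j\<in>I - partners i. \<exists>z\<in>petal j. adj x z \<and> c z = \<gamma>"
    if "\<gamma> \<in> {\<gamma> \<in> palette i. blocked I c x \<gamma>}" for \<gamma>
    using that assms no_edge_between_partner_petals unfolding blocked_def by blast
  show "\<gamma> = \<gamma>'" if "j \<in> I - partners i" "\<exists>z\<in>petal j. adj x z \<and> c z = \<gamma>"
    "\<exists>z\<in>petal j. adj x z \<and> c z = \<gamma>'" for \<gamma> \<gamma>' j
    using that assms unique_neighbour_in_petal[of i j x] by blast
qed

text \<open>
  A filled petal contains at most one vertex of colour \<open>\<gamma>\<close>, and this vertex has at most one
  neighbour in the petal \<open>i\<close>.
\<close>

lemma vertices_blocked_for_colour: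
  assumes "fills I c" "i \<in> {1..d}" "I \<subseteq> {1..d}" "i \<notin> I"
  shows "card {x \<in> petal i. blocked I c x \<gamma>} \<le> card (I - partners i)"
proof (rule card_le_of_private_witness[where Q = "\<lambda>x j. \<exists>z\<in>petal j. adj x z \<and> c z = \<gamma>"])
  show "finite (I - partners i)"
    using \<open>I \<subseteq> {1..d}\<close> finite_subset by blast
  show "\<exists>j\<in>I - partners i. \<exists>z\<in>petal j. adj x z \<and> c z = \<gamma>"
    if "x \<in> {x \<in> petal i. blocked I c x \<gamma>}" for x
    using that assms no_edge_between_partner_petals unfolding blocked_def by blast
  show "x = x'" if "x \<in> {x \<in> petal i. blocked I c x \<gamma>}" "x' \<in> {x \<in> petal i. blocked I c x \<gamma>}"
    and j: "j \<in> I - partners i" and w: "\<exists>z\<in>petal j. adj x z \<and> c z = \<gamma>"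
    "\<exists>z\<in>petal j. adj x' z \<and> c z = \<gamma>" for x x' j
  proof -
    obtain z z' where z: "z \<in> petal j" "adj x z" "c z = \<gamma>" "z' \<in> petal j" "adj x' z'" "c z' = \<gamma>"
      using w by blast
    have "inj_on c (petal j)" using assms(1) j by (auto simp: fills_def bij_betw_def)
    then have "z = z'" using z by (auto dest: inj_onD)
    then show ?thesis
      using that(1,2) z j assms adj_sym unique_neighbour_in_petal[of j i z x x'] by blast
  qed
qed

lemma fills_insert:
  assumes "fills I c" "i \<in> {1..d}" "I \<subseteq> {1..d}" "i \<notin> I"
    and f: "bij_betw f (petal i) (palette i)" "\<And>x. x \<in> petal i \<Longrightarrow> \<not> blocked I c x (f x)"
  shows "fills (insert i I) (\<lambda>x. if x \<in> petal i then f x else c x)"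
proof -
  let ?g = "\<lambda>x. if x \<in> petal i then f x else c x"
  have off: "?g x = c x" if "x \<in> petal j" "j \<in> I" for x j
    using that petal_disjoint[of i j x] assms by auto
  have "bij_betw ?g (petal i) (palette i)"
    using f(1) by (subst bij_betw_cong[of _ _ f]) auto
  moreover have "bij_betw ?g (petal j) (palette j)" if "j \<in> I" for j
    using assms(1) that off by (subst bij_betw_cong[of _ _ c]) (auto simp: fills_def)
  moreover have ii: "?g x \<noteq> ?g z" if "x \<in> petal i" "z \<in> petal i" "adj x z" for x z
    using that f(1) adj_irrefl by (auto simp: bij_betw_def inj_on_def)
  moreover have ij: "?g x \<noteq> ?g z" if "x \<in> petal i" "z \<in> petal j" "j \<in> I" "adj x z" for x z j
  proof -
    have "?g x = f x" "?g z = c z" using that off by auto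
    then show ?thesis using f(2)[OF that(1)] that unfolding blocked_def by metis
  qed
  moreover have "?g x \<noteq> ?g z"
    if "x \<in> petal j" "z \<in> petal i" "j \<in> I" "adj x z" for x z j
    using ij[of z x j] that adj_sym by metis
  moreover have "?g x \<noteq> ?g z"
    if "x \<in> petal j" "z \<in> petal k" "j \<in> I" "k \<in> I" "adj x z" for x z j k
    using that off[of x j] off[of z k] assms(1) unfolding fills_def by metis
  ultimately show ?thesis unfolding fills_def by blast
qed

lemma fills_extend:
  assumes "fills I c" "i \<in> {1..d}" "I \<subseteq> {1..d}" "i \<notin> I"
    and "2 * card (I - partners i) \<le> card (palette i)"
  shows "\<exists>c'. fills (insert i I) c'"
proof -
  have "\<exists>f. bij_betw f (petal i) (palette i) \<and> (\<forall>x\<in>petal i. \<not> blocked I c x (f x))"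
    using assms card_petal colours_blocked_for_vertex vertices_blocked_for_colour
      finite_petal finite_palette
    by (intro bij_avoiding_sparse[where p = "card (I - partners i)" and q = "card (I - partners i)"])
      auto
  then show ?thesis using fills_insert[OF assms(1-4)] by blast
qed

lemma fills_extend_avoiding:
  assumes "fills I c" "i \<in> {1..d}" "I \<subseteq> {1..d}" "i \<notin> I"
    and "2 * card (I - partners i) < card (palette i)" "0 < card (I - partners i)"
    and "x0 \<in> petal i"
  obtains c' where "fills (insert i I) c'" "c' x0 \<noteq> y0"
    "\<And>j x. j \<in> I \<Longrightarrow> x \<in> petal j \<Longrightarrow> c' x = c x"
proof -
  have "\<exists>f. bij_betw f (petal i) (palette i) \<and> (\<forall>x\<in>petal i. \<not> blocked I c x (f x)) \<and> f x0 \<noteq> y0"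
    using assms card_petal colours_blocked_for_vertex vertices_blocked_for_colour
      finite_petal finite_palette
    by (intro bij_avoiding_sparse_and_value[where p = "card (I - partners i)"
          and q = "card (I - partners i)"]) auto
  then obtain f where f: "bij_betw f (petal i) (palette i)"
    "\<And>x. x \<in> petal i \<Longrightarrow> \<not> blocked I c x (f x)" "f x0 \<noteq> y0"
    by blast
  show thesis
  proof (rule that[OF fills_insert[OF assms(1-4) f(1,2)]])
    show "(if x0 \<in> petal i then f x0 else c x0) \<noteq> y0" using f(3) assms(7) by simp
    show "(if x \<in> petal i then f x else c x) = c x" if "j \<in> I" "x \<in> petal j" for j x
      using that assms(2-4) petal_disjoint[of i j x] by auto
  qed
qed

section \<open>Filling more than half of the petals\<close>

text \<open>
  For \<open>p < d div 2\<close> filled petals, \<open>2 p \<le> d - 2\<close>, and the next petal has at least \<open>d - 2\<close> vertices.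
\<close>

lemma fills_half:
  assumes "finite I" "I \<subseteq> {1..d}" "card I \<le> d div 2"
  shows "\<exists>c. fills I c"
  using assms
proof (induction I rule: finite_induct)
  case empty
  then show ?case by (simp add: fills_def)
next
  case (insert i I)
  then obtain c where "fills I c" by auto
  moreover have "card (I - partners i) \<le> card I"
    using insert by (auto intro: card_mono)
  then have "2 * card (I - partners i) \<le> card (palette i)"
    using insert.prems insert.hyps card_palette[of i] card_partners_le[of i] by auto
  ultimately show ?case using insert by (intro fills_extend) auto
qed

text \<open>
  A vertex \<open>x\<close> that is denied more colours after the petal \<open>j\<close> has been filled is denied exactly one
  more, the colour of its unique neighbour there.
\<close>

lemma critical_row:
  assumes "i \<in> {1..d}" "j \<in> {1..d}" "i \<noteq> j" "x \<in> petal i"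
    and C: "{\<gamma> \<in> palette i. blocked (insert j I) c x \<gamma>} = C"
    and lt: "card {\<gamma> \<in> palette i. blocked I c x \<gamma>} < card C"
  obtains y where "y \<in> petal j" "adj x y" "c y \<notin> {\<gamma> \<in> palette i. blocked I c x \<gamma>}"
    "C = insert (c y) {\<gamma> \<in> palette i. blocked I c x \<gamma>}"
proof -
  let ?F = "{\<gamma> \<in> palette i. blocked I c x \<gamma>}"
  have "\<not> C \<subseteq> ?F"
    using lt card_mono[of ?F C] finite_palette by auto
  then obtain \<gamma> where \<gamma>: "\<gamma> \<in> C" "\<gamma> \<notin> ?F" by blast
  then obtain y where y: "y \<in> petal j" "adj x y" "c y = \<gamma>"
    using C by (auto simp: blocked_def)
  have "C = insert (c y) ?F"
  proof
    show "C \<subseteq> insert (c y) ?F"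
      using C y unique_neighbour_in_petal[OF assms(1-4)] by (auto simp: blocked_def)
    show "insert (c y) ?F \<subseteq> C"
      using C y \<gamma> by (auto simp: blocked_def)
  qed
  then show thesis using that[of y] y \<gamma> by blast
qed

text \<open>
  Suppose that the last petal \<open>i\<close> cannot be filled, with obstruction \<open>(A1, C1)\<close> as in
  \<open>critical_obstruction\<close>. Let \<open>F x\<close> be the set of colours denied to \<open>x\<close> by the petals in \<open>I\<close>, that
  is by all filled petals except \<open>j\<close>. For \<open>x \<in> A1\<close> the set \<open>C1\<close> consists of \<open>F x\<close> and of the
  colour of the neighbour of \<open>x\<close> in the petal \<open>j\<close>. Refill the petal \<open>j\<close> so that the colour of one
  such neighbour \<open>y0\<close> changes, and suppose that the result is obstructed again, by \<open>(A2, C2)\<close>.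

  As the petal \<open>i\<close> has only \<open>2 m - 1\<close> vertices, \<open>A1\<close> and \<open>A2\<close> have a common element \<open>w\<close>. For
  \<open>x \<in> A1 - A2\<close> the sets \<open>F x\<close> and \<open>F w\<close> would be disjoint subsets of \<open>C1\<close> of size \<open>m - 1\<close>, which is
  too much; so \<open>A1 \<subseteq> A2\<close>. Now take \<open>x0 \<in> A1\<close> adjacent to \<open>y0\<close> and a second element \<open>x1\<close> of
  \<open>A1\<close>. The old colour of \<open>y0\<close> lies in \<open>C1\<close>, hence in \<open>F x1\<close>, hence in \<open>C2\<close>, but not in \<open>F x0\<close>. So
  it is also the new colour of \<open>y0\<close>, a contradiction.
\<close>

lemma fills_extend_after_recolouring:
  assumes ind: "\<And>k. k \<in> {1..d} \<Longrightarrow> partners k = {}"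
    and d: "d = 2 * m" "m \<ge> 3"
    and I: "I \<subseteq> {1..d}" "card I = m - 1"
    and ij: "i \<in> {1..d}" "j \<in> {1..d}" "i \<noteq> j" "i \<notin> I" "j \<notin> I"
    and c1: "fills (insert j I) c1"
  shows "\<exists>c. fills (insert i (insert j I)) c"
proof (rule ccontr)
  assume stuck: "\<not> ?thesis"
  let ?J = "insert j I"
  define F where "F x = {\<gamma> \<in> palette i. blocked I c1 x \<gamma>}" for x
  have finI: "finite I" using I(1) by (rule finite_subset) simp
  have J: "?J \<subseteq> {1..d}" "i \<notin> ?J" "card (?J - partners i) = m"
    using I ij d finI ind by auto
  have n: "card (petal i) = 2 * m - 1" "card (palette i) = 2 * m - 1" "card (palette j) = 2 * m - 1"
    using card_petal card_palette ind ij d by auto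
  have F_card: "card (F x) \<le> m - 1" if "x \<in> petal i" for x
    using colours_blocked_for_vertex[OF ij(1) I(1) ij(4) that] I(2) ind ij by (simp add: F_def)
  have finF: "finite (F x)" for x using finite_palette by (simp add: F_def)
  \<comment> \<open>All \<open>c\<close> considered agree with \<open>c1\<close> on the petals in \<open>I\<close>, so one \<open>F\<close> serves them all.\<close>
  have obstruction: "\<exists>A C. A \<subseteq> petal i \<and> card A = m \<and> card C = m
      \<and> (\<forall>x\<in>petal i - A. F x \<inter> C = {})
      \<and> (\<forall>x\<in>A. card (F x) = m - 1 \<and> F x \<subseteq> C \<and>
            (\<exists>y\<in>petal j. adj x y \<and> c y \<notin> F x \<and> C = insert (c y) (F x)))"
    if c: "fills ?J c" and agree: "\<forall>k\<in>I. \<forall>x\<in>petal k. c x = c1 x" for c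
  proof -
    have b: "blocked I c x \<gamma> \<longleftrightarrow> blocked I c1 x \<gamma>" for x \<gamma>
      using agree unfolding blocked_def by metis
    have no: "\<nexists>f. bij_betw f (petal i) (palette i) \<and> (\<forall>x\<in>petal i. \<not> blocked ?J c x (f x))"
      using fills_insert[OF c ij(1) J(1,2)] stuck by blast
    have row: "card {\<gamma> \<in> palette i. blocked ?J c x \<gamma>} \<le> m" if "x \<in> petal i" for x
      using colours_blocked_for_vertex[OF ij(1) J(1,2) that] J(3) by metis
    have col: "card {x \<in> petal i. blocked ?J c x \<gamma>} \<le> m" for \<gamma>
      using vertices_blocked_for_colour[OF c ij(1) J(1,2)] J(3) by metis
    have sum: "m + m = Suc (card (petal i))" using n d by simp
    have "\<exists>A C. A \<subseteq> petal i \<and> C \<subseteq> palette i \<and> card A = m \<and> card C = m \<and>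
        (\<forall>x\<in>A. {\<gamma> \<in> palette i. blocked ?J c x \<gamma>} = C) \<and>
        (\<forall>\<gamma>\<in>C. {x \<in> petal i. blocked ?J c x \<gamma>} = A)"
      by (rule critical_obstruction[OF finite_petal finite_palette card_petal[OF ij(1)]
            row col sum no])
    then obtain A C where AC: "A \<subseteq> petal i" "C \<subseteq> palette i" "card A = m" "card C = m"
      "\<forall>x\<in>A. {\<gamma> \<in> palette i. blocked ?J c x \<gamma>} = C"
      "\<forall>\<gamma>\<in>C. {x \<in> petal i. blocked ?J c x \<gamma>} = A"
      by (elim exE conjE) (rule that; assumption)
    have outside: "F x \<inter> C = {}" if "x \<in> petal i - A" for x
      using that AC(6) b unfolding F_def blocked_def by blast
    have inside: "card (F x) = m - 1 \<and> F x \<subseteq> C \<and>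
        (\<exists>y\<in>petal j. adj x y \<and> c y \<notin> F x \<and> C = insert (c y) (F x))" if x: "x \<in> A" for x
    proof -
      have xi: "x \<in> petal i" using x AC(1) by blast
      have Fx: "{\<gamma> \<in> palette i. blocked I c x \<gamma>} = F x" by (simp add: F_def b)
      have "card (F x) < card C" using F_card[OF xi] AC(4) d by simp
      then obtain y where y: "y \<in> petal j" "adj x y" "c y \<notin> F x" "C = insert (c y) (F x)"
        by (rule critical_row[OF ij(1-3) xi bspec[OF AC(5) x], unfolded Fx]) (rule that; assumption)
      then have "card C = Suc (card (F x))" using finF by simp
      then show ?thesis using y AC(4) by auto
    qed
    show ?thesis
      by (intro exI[of _ A] exI[of _ C] conjI[OF AC(1)] conjI[OF AC(3)] conjI[OF AC(4)])
        (use outside inside in \<open>simp only: Ball_def, blast\<close>)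
  qed
  obtain A1 C1 where A1: "A1 \<subseteq> petal i" "card A1 = m" "card C1 = m"
    and A1_all: "\<forall>x\<in>A1. card (F x) = m - 1 \<and> F x \<subseteq> C1 \<and>
      (\<exists>y\<in>petal j. adj x y \<and> c1 y \<notin> F x \<and> C1 = insert (c1 y) (F x))"
    using obstruction[OF c1 ballI[OF ballI[OF refl]]] by (elim exE conjE) (rule that; assumption)
  have A1_row: "card (F x) = m - 1" "F x \<subseteq> C1"
    "\<exists>y\<in>petal j. adj x y \<and> c1 y \<notin> F x \<and> C1 = insert (c1 y) (F x)" if "x \<in> A1" for x
    using bspec[OF A1_all that] by simp_all
  obtain x0 where x0: "x0 \<in> A1" using A1(2) d by fastforce
  obtain y0 where y0: "y0 \<in> petal j" "adj x0 y0" "c1 y0 \<notin> F x0" "C1 = insert (c1 y0) (F x0)"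
    using A1_row(3)[OF x0] by blast
  have "fills I c1" using c1 by (auto simp: fills_def)
  moreover have "2 * card (I - partners j) < card (palette j)" "0 < card (I - partners j)"
    using n I d ind[OF ij(2)] by auto
  ultimately obtain c2 where c2: "fills ?J c2" "c2 y0 \<noteq> c1 y0"
    "\<forall>k\<in>I. \<forall>x\<in>petal k. c2 x = c1 x"
    using fills_extend_avoiding[of I c1 j y0 "c1 y0"] ij I y0 by metis
  obtain A2 C2 where A2: "A2 \<subseteq> petal i" "card A2 = m" "card C2 = m"
    "\<forall>x\<in>petal i - A2. F x \<inter> C2 = {}"
    and A2_all: "\<forall>x\<in>A2. card (F x) = m - 1 \<and> F x \<subseteq> C2 \<and>
      (\<exists>y\<in>petal j. adj x y \<and> c2 y \<notin> F x \<and> C2 = insert (c2 y) (F x))"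
    using obstruction[OF c2(1,3)] by (elim exE conjE) (rule that; assumption)
  have A2_row: "card (F x) = m - 1" "F x \<subseteq> C2"
    "\<exists>y\<in>petal j. adj x y \<and> c2 y \<notin> F x \<and> C2 = insert (c2 y) (F x)" if "x \<in> A2" for x
    using bspec[OF A2_all that] by simp_all
  have fin: "finite A1" "finite A2" "finite C1"
    using finite_subset[OF A1(1) finite_petal] finite_subset[OF A2(1) finite_petal]
      card_ge_0_finite[of C1] A1(3) d by simp_all
  have "A1 \<inter> A2 \<noteq> {}"
  proof
    assume "A1 \<inter> A2 = {}"
    then have "card (A1 \<union> A2) = 2 * m"
      using A1(2) A2(2) fin by (simp add: card_Un_disjoint)
    moreover have "card (A1 \<union> A2) \<le> card (petal i)"
      using A1(1) A2(1) finite_petal by (intro card_mono) auto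
    ultimately show False using n d by simp
  qed
  then obtain w where w: "w \<in> A1" "w \<in> A2" by blast
  have sub: "A1 \<subseteq> A2"
  proof
    fix x assume x: "x \<in> A1"
    show "x \<in> A2"
    proof (rule ccontr)
      assume "x \<notin> A2"
      then have "F x \<inter> F w = {}" using A2(4) A2_row(2)[OF w(2)] x A1(1) by blast
      then have "card (F x \<union> F w) = 2 * (m - 1)"
        using A1_row(1) x w finF by (simp add: card_Un_disjoint)
      moreover have "card (F x \<union> F w) \<le> card C1"
        using A1_row(2)[OF x] A1_row(2)[OF w(1)] fin by (intro card_mono) auto
      ultimately show False using A1(3) d by linarith
    qed
  qed
  have "\<not> A1 \<subseteq> {x0}"
    using card_mono[of "{x0}" A1] A1(2) d by auto
  then obtain x1 where x1: "x1 \<in> A1" "x1 \<noteq> x0" by blast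
  obtain y1 where y1: "y1 \<in> petal j" "adj x1 y1" "C1 = insert (c1 y1) (F x1)"
    using A1_row(3)[OF x1(1)] by blast
  have "y1 \<noteq> y0"
    using unique_neighbour_in_petal[of j i y0 x0 x1] ij x1 x0 y0 y1 A1(1) adj_sym by blast
  then have "c1 y0 \<noteq> c1 y1"
    using c1 y0(1) y1(1) by (auto simp: fills_def bij_betw_def inj_on_def)
  moreover have "c1 y0 \<in> insert (c1 y1) (F x1)"
    unfolding y1(3)[symmetric] y0(4) by simp
  ultimately have "c1 y0 \<in> F x1" by simp
  then have "c1 y0 \<in> C2" using A2_row(2) x1(1) sub by blast
  obtain y2 where y2: "y2 \<in> petal j" "adj x0 y2" "C2 = insert (c2 y2) (F x0)"
    using A2_row(3) x0 sub by blast
  have "c1 y0 = c2 y2" using \<open>c1 y0 \<in> C2\<close> y0(3) unfolding y2(3) by simp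
  moreover have "y2 = y0"
    using unique_neighbour_in_petal[of i j x0] ij x0 A1(1) y0 y2 by blast
  ultimately show False using c2(2) by simp
qed

text \<open>
  If two neighbours of the root are adjacent, both are taken and one of their petals is filled last.
  Then only \<open>d div 2 - 1\<close> petals deny colours in the last one, which has \<open>d - 2\<close> vertices.
  Otherwise the last petal has \<open>d - 1\<close> vertices, which suffices for odd \<open>d\<close>; for even \<open>d\<close> an earlier
  petal may have to be recoloured.
\<close>

lemma fills_more_than_half:
  assumes "d \<ge> 6"
  shows "\<exists>I c. I \<subseteq> {1..d} \<and> card I = Suc (d div 2) \<and> fills I c"
proof (cases "\<forall>k\<in>{1..d}. partners k = {}")
  case ind: True
  define h where "h = d div 2"
  have h: "h \<ge> 3" "Suc h \<le> d" using assms by (auto simp: h_def)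
  let ?I = "{1..h - 1}"
  have ins: "insert h ?I = {1..h}" "insert (Suc h) {1..h} = {1..Suc h}"
    using h by auto
  obtain c where c: "fills {1..h} c"
    using fills_half[of "{1..h}"] h by (auto simp: h_def)
  have "\<exists>c. fills {1..Suc h} c"
  proof (cases "even d")
    case True
    have "\<exists>c. fills (insert (Suc h) (insert h ?I)) c"
    proof (rule fills_extend_after_recolouring)
      show "partners k = {}" if "k \<in> {1..d}" for k using ind that by blast
      show "d = 2 * h" using True by (simp add: h_def)
      show "fills (insert h ?I) c" using c ins by simp
    qed (use h in auto)
    then show ?thesis unfolding ins .
  next
    case False
    then have odd: "2 * h \<le> d - 1" by (auto simp: h_def elim: oddE)
    have Suc_h: "Suc h \<in> {1..d}" using h by simp
    have "\<exists>c. fills (insert (Suc h) {1..h}) c"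
    proof (rule fills_extend[OF c Suc_h])
      show "2 * card ({1..h} - partners (Suc h)) \<le> card (palette (Suc h))"
        using odd card_palette[OF Suc_h] bspec[OF ind Suc_h] by simp
    qed (use h in auto)
    then show ?thesis unfolding ins .
  qed
  then show ?thesis using h by (intro exI[of _ "{1..Suc h}"]) (auto simp: h_def)
next
  case False
  then obtain i j where ij: "i \<in> {1..d}" "j \<in> partners i" by blast
  then have j: "j \<in> {1..d}" "j \<noteq> i" using adj_irrefl by (auto simp: partners_def)
  have "card ({1..d} - {i, j}) = d - 2"
    using ij j by (subst card_Diff_subset) auto
  then have "d div 2 - 1 \<le> card ({1..d} - {i, j})" using assms by linarith
  then obtain I0 where I0: "I0 \<subseteq> {1..d} - {i, j}" "card I0 = d div 2 - 1" "finite I0"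
    by (rule obtain_subset_with_card_n)
  let ?I = "insert j I0"
  have I: "?I \<subseteq> {1..d}" "i \<notin> ?I" "card ?I = d div 2" "finite ?I"
  proof -
    have "j \<notin> I0" using I0(1) by blast
    then show "card ?I = d div 2" using I0(2,3) assms by simp
    show "?I \<subseteq> {1..d}" "i \<notin> ?I" "finite ?I" using I0(1,3) j by blast+
  qed
  obtain c where c: "fills ?I c" using fills_half[OF I(4,1)] I(3) by auto
  have "card (?I - partners i) \<le> card I0"
    using ij(2) by (intro card_mono[OF I0(3)]) blast
  then have "2 * card (?I - partners i) \<le> card (palette i)"
    using I0(2) assms card_palette[OF ij(1)] card_partners_le[OF ij(1)] by linarith
  then obtain c' where "fills (insert i ?I) c'"
    using fills_extend[OF c ij(1) I(1,2)] by blast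
  then show ?thesis
    using I ij(1) by (intro exI[of _ "insert i ?I"] exI[of _ c'] conjI) simp_all
qed

end

section \<open>From filled petals to a colouring of the graph\<close>

text \<open>
  A vertex with at most \<open>d\<close> neighbours always has one of \<open>d + 1\<close> colours left, so the vertices of \<open>U\<close>
  can be added one by one.
\<close>

lemma greedy_extension:
  fixes adj :: "'a \<Rightarrow> 'a \<Rightarrow> bool" and c :: "'a \<Rightarrow> nat"
  assumes sym: "\<And>u w. adj u w \<Longrightarrow> adj w u" and irrefl: "\<And>u. \<not> adj u u"
    and "finite U"
    and deg: "\<And>u. u \<in> U \<Longrightarrow> finite {w. adj u w} \<and> card {w. adj u w} \<le> d"
    and range: "\<And>u. u \<in> W \<Longrightarrow> c u \<in> {1..d + 1}"
    and proper: "\<And>u w. u \<in> W \<Longrightarrow> w \<in> W \<Longrightarrow> adj u w \<Longrightarrow> c u \<noteq> c w"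
  shows "\<exists>c'. (\<forall>u\<in>W \<union> U. c' u \<in> {1..d + 1}) \<and>
    (\<forall>u\<in>W \<union> U. \<forall>w\<in>W \<union> U. adj u w \<longrightarrow> c' u \<noteq> c' w) \<and> (\<forall>u\<in>W. c' u = c u)"
  using \<open>finite U\<close> deg
proof (induction U rule: finite_induct)
  case empty
  show ?case using range proper by (intro exI[of _ c]) simp
next
  case (insert u U)
  then obtain c' where c': "\<forall>x\<in>W \<union> U. c' x \<in> {1..d + 1}"
    "\<forall>x\<in>W \<union> U. \<forall>w\<in>W \<union> U. adj x w \<longrightarrow> c' x \<noteq> c' w" "\<forall>x\<in>W. c' x = c x"
    by auto
  show ?case
  proof (cases "u \<in> W")
    case True
    then show ?thesis using c' by (intro exI[of _ c']) (simp add: insert_absorb)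
  next
    case False
    have "card (c' ` {w. adj u w}) \<le> d"
      using insert.prems[of u] card_image_le[of "{w. adj u w}" c'] by simp
    then have "\<not> {1..d + 1} \<subseteq> c' ` {w. adj u w}"
      using insert.prems[of u] card_mono[of "c' ` {w. adj u w}" "{1..d + 1}"] by auto
    then obtain \<gamma> where \<gamma>: "\<gamma> \<in> {1..d + 1}" "\<gamma> \<notin> c' ` {w. adj u w}" by blast
    have new: "c' w \<noteq> \<gamma>" if "adj u w" for w using that \<gamma>(2) by blast
    let ?c = "c'(u := \<gamma>)"
    have "?c x \<noteq> ?c w"
      if "x \<in> W \<union> insert u U" "w \<in> W \<union> insert u U" "adj x w" for x w
    proof -
      have "x \<noteq> w" using that(3) irrefl by blast
      then consider "x = u" "w \<noteq> u" | "x \<noteq> u" "w = u" | "x \<noteq> u" "w \<noteq> u"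
        by blast
      then show ?thesis
      proof cases
        case 1
        then show ?thesis using new[of w] that(3) by simp
      next
        case 2
        then show ?thesis using new[of x] sym[OF that(3)] by simp
      next
        case 3
        then show ?thesis using c'(2) that by simp
      qed
    qed
    moreover have "\<forall>x\<in>W \<union> insert u U. ?c x \<in> {1..d + 1}" using c'(1) \<gamma>(1) by simp
    moreover have "\<forall>x\<in>W. ?c x = c x" using c'(3) False by simp
    ultimately show ?thesis by blast
  qed
qed

context c4_free_rooted
begin

text \<open>
  The root, its neighbours and the filled petals are already properly coloured: a neighbour \<open>e i\<close>
  has neighbours in no petal but its own, whose palette omits \<open>i\<close>, and the root has none in any
  petal. The other vertices are coloured greedily.
\<close>

lemma colouring_of_filled_petals:
  assumes I: "I \<subseteq> {1..d}" and c: "fills I c"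
  obtains col where "\<And>u. u \<in> V \<Longrightarrow> col u \<in> {1..d + 1}"
    and "\<And>u w. adj u w \<Longrightarrow> col u \<noteq> col w"
    and "col v = d + 1" and "\<And>i. i \<in> {1..d} \<Longrightarrow> col (e i) = i"
    and "\<And>i \<gamma>. i \<in> I \<Longrightarrow> \<gamma> \<in> {1..d + 1} - {i} \<Longrightarrow> \<exists>u. adj (e i) u \<and> col u = \<gamma>"
proof -
  define W where "W = insert v (e ` {1..d}) \<union> (\<Union>i\<in>I. petal i)"
  define c0 where "c0 x = (if x = v then d + 1 else if adj v x then inv_into {1..d} e x else c x)" for x
  have W_cases: thesis if "x \<in> W" "x = v \<Longrightarrow> thesis" "\<And>i. i \<in> {1..d} \<Longrightarrow> x = e i \<Longrightarrow> thesis"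
    "\<And>i. i \<in> I \<Longrightarrow> x \<in> petal i \<Longrightarrow> thesis" for x thesis
    using that unfolding W_def by blast
  have c0_v: "c0 v = d + 1" by (simp add: c0_def)
  have c0_e: "c0 (e i) = i" if "i \<in> {1..d}" for i
  proof -
    have "e i \<noteq> v" using adj_e[OF that] adj_irrefl by metis
    moreover have "inv_into {1..d} e (e i) = i"
      by (rule inv_into_f_f[OF bij_betw_imp_inj_on[OF e_bij] that])
    ultimately show ?thesis using adj_e[OF that] by (simp add: c0_def)
  qed
  have c0_petal: "c0 x = c x" if "x \<in> petal i" for x i
    using that by (simp add: c0_def petal_def)
  have c_bij: "bij_betw c (petal i) (palette i)" if "i \<in> I" for i
    using c that by (simp add: fills_def)
  have c_palette: "c0 x \<in> palette i" if "i \<in> I" "x \<in> petal i" for x i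
    using bij_betw_apply[OF c_bij[OF that(1)] that(2)] c0_petal[OF that(2)] by simp
  have range: "c0 x \<in> {1..d + 1}" if "x \<in> W" for x
    using that
  proof (rule W_cases)
    show ?thesis if "x = v" using that c0_v by simp
    show ?thesis if "i \<in> {1..d}" "x = e i" for i using that c0_e[of i] by simp
    show ?thesis if "i \<in> I" "x \<in> petal i" for i
      using c_palette[OF that] by (simp add: palette_def)
  qed
  have v_proper: "c0 v \<noteq> c0 x" if "x \<in> W" "adj v x" for x
    using that(1)
  proof (rule W_cases)
    show ?thesis if "x = v" using that \<open>adj v x\<close> adj_irrefl by simp
    show ?thesis if "i \<in> {1..d}" "x = e i" for i using that c0_e[of i] c0_v by simp
    show ?thesis if "i \<in> I" "x \<in> petal i" for i
      using that \<open>adj v x\<close> by (simp add: petal_def)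
  qed
  have e_proper: "c0 (e i) \<noteq> c0 x" if "i \<in> {1..d}" "x \<in> W" "adj (e i) x" for i x
    using that(2)
  proof (rule W_cases)
    show ?thesis if "x = v" using that c0_e[OF \<open>i \<in> {1..d}\<close>] c0_v \<open>i \<in> {1..d}\<close> by simp
    show ?thesis if "j \<in> {1..d}" "x = e j" for j
      using that c0_e[of j] c0_e[OF \<open>i \<in> {1..d}\<close>] \<open>adj (e i) x\<close> adj_irrefl by auto
    show ?thesis if j: "j \<in> I" "x \<in> petal j" for j
    proof -
      have "x \<in> petal i" using j(2) \<open>adj (e i) x\<close> by (simp add: petal_def)
      then have "i = j" using petal_disjoint[of i j x] j I \<open>i \<in> {1..d}\<close> by blast
      then show ?thesis
        using c_palette[OF j] c0_e[OF \<open>i \<in> {1..d}\<close>] by (auto simp: palette_def)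
    qed
  qed
  have proper: "c0 x \<noteq> c0 y" if "x \<in> W" "y \<in> W" "adj x y" for x y
    using that(1)
  proof (rule W_cases)
    show ?thesis if "x = v" using that v_proper \<open>y \<in> W\<close> \<open>adj x y\<close> by simp
    show ?thesis if "i \<in> {1..d}" "x = e i" for i using that e_proper \<open>y \<in> W\<close> \<open>adj x y\<close> by simp
    show ?thesis if i: "i \<in> I" "x \<in> petal i" for i
      using \<open>y \<in> W\<close>
    proof (rule W_cases)
      show ?thesis if "y = v"
        using that v_proper[OF \<open>x \<in> W\<close>] adj_sym[OF \<open>adj x y\<close>] by simp
      show ?thesis if "j \<in> {1..d}" "y = e j" for j
        using that e_proper[OF that(1) \<open>x \<in> W\<close>] adj_sym[OF \<open>adj x y\<close>] by simp
      show ?thesis if "j \<in> I" "y \<in> petal j" for j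
        using c i that \<open>adj x y\<close> c0_petal[OF i(2)] c0_petal[OF that(2)] by (simp add: fills_def)
    qed
  qed
  have "\<exists>c'. (\<forall>u\<in>W \<union> V. c' u \<in> {1..d + 1}) \<and>
    (\<forall>u\<in>W \<union> V. \<forall>w\<in>W \<union> V. adj u w \<longrightarrow> c' u \<noteq> c' w) \<and> (\<forall>u\<in>W. c' u = c0 u)"
  proof (rule greedy_extension[OF adj_sym adj_irrefl finite_V _ range proper])
    show "finite {w. adj u w} \<and> card {w. adj u w} \<le> d" if "u \<in> V" for u
      using finite_adj degree[OF that] by simp
  qed
  then obtain col where col: "\<forall>u\<in>W \<union> V. col u \<in> {1..d + 1}"
    "\<forall>u\<in>W \<union> V. \<forall>w\<in>W \<union> V. adj u w \<longrightarrow> col u \<noteq> col w" "\<forall>u\<in>W. col u = c0 u"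
    by blast
  have col_v: "col v = d + 1" using col(3) c0_v by (simp add: W_def)
  have col_e: "col (e i) = i" if "i \<in> {1..d}" for i
    using col(3) c0_e[OF that] that by (simp add: W_def)
  show thesis
  proof (rule that[OF _ _ col_v col_e])
    show "col u \<in> {1..d + 1}" if "u \<in> V" for u using col(1) that by blast
    show "col u \<noteq> col w" if "adj u w" for u w
      using col(2) that adj_V[OF that] adj_V[OF adj_sym[OF that]] by blast
    show "\<exists>u. adj (e i) u \<and> col u = \<gamma>" if i: "i \<in> I" and \<gamma>: "\<gamma> \<in> {1..d + 1} - {i}" for i \<gamma>
    proof -
      have id: "i \<in> {1..d}" using i I by blast
      consider "\<gamma> = d + 1" | "\<gamma> \<in> partners i" | "\<gamma> \<in> palette i"
        using \<gamma> by (fastforce simp: palette_def)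
      then show ?thesis
      proof cases
        case 1
        then show ?thesis using col_v adj_sym[OF adj_e[OF id]] by (intro exI[of _ v]) simp
      next
        case 2
        then show ?thesis using col_e[of \<gamma>] by (auto simp: partners_def)
      next
        case 3
        then have "\<gamma> \<in> c ` petal i" unfolding bij_betw_imp_surj_on[OF c_bij[OF i]] .
        then obtain x where x: "x \<in> petal i" "c x = \<gamma>" by blast
        have "x \<in> W" unfolding W_def using i x(1) by blast
        then have "col x = \<gamma>" using col(3) c0_petal[OF x(1)] x(2) by simp
        then show ?thesis using x(1) by (auto simp: petal_def)
      qed
    qed
  qed
qed

end

section \<open>Dominant vertices of distinct colours\<close>

lemma C4_free_common_neighbours:
  assumes "pair_graph G" "C4_free G"
    and ua: "(u, a) \<in> parcs G" and ub: "(u, b) \<in> parcs G"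
    and wa: "(w, a) \<in> parcs G" and wb: "(w, b) \<in> parcs G" and "u \<noteq> w"
  shows "a = b"
proof (rule ccontr)
  assume "a \<noteq> b"
  interpret pair_graph G by fact
  have sym: "(y, x) \<in> parcs G" if "(x, y) \<in> parcs G" for x y
    using that pair_sym_arcs by (auto simp: symmetric_def dest: symD)
  have ne: "x \<noteq> y" if "(x, y) \<in> parcs G" for x y
    using pair_no_loops[OF that] by simp
  let ?p = "[(u, a), (a, w), (w, b), (b, u)]"
  have "u \<in> pverts G" using ua by (rule in_arcsD1)
  then have "pre_digraph.awalk (with_proj G) u ?p u"
    using ua wb sym[OF wa] sym[OF ub] by (simp add: pre_digraph.awalk_def cas_with_proj_eq)
  moreover have "distinct (tl (pre_digraph.awalk_verts (with_proj G) u ?p))"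
    using \<open>a \<noteq> b\<close> \<open>u \<noteq> w\<close> ne[OF ua] ne[OF ub] ne[OF wa] ne[OF wb]
    by (auto simp: awalk_verts_with_proj_eq)
  ultimately have "pre_digraph.cycle (with_proj G) ?p"
    unfolding pre_digraph.cycle_def by blast
  moreover have "length ?p = 4" by simp
  ultimately show False using \<open>C4_free G\<close> unfolding C4_free_def by blast
qed

text \<open>
  The maximum in the definition is over a finite set, since all the sets \<open>S\<close> consist of vertices.
\<close>

lemma f_chromatic_vertex_number_ge:
  assumes "finite (pverts G)" "proper_coloring G (d + 1) c"
    and "S \<subseteq> {v. dominant G (d + 1) c v}" "inj_on c S"
  shows "card S \<le> f_chromatic_vertex_number G d"
proof -
  let ?M = "{card S | c S. proper_coloring G (d + 1) c \<and>
    S \<subseteq> {v. dominant G (d + 1) c v} \<and> inj_on c S}"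
  have "?M \<subseteq> {..card (pverts G)}"
  proof
    fix k assume "k \<in> ?M"
    then obtain c S where k: "k = card S" "S \<subseteq> {v. dominant G (d + 1) c v}" by blast
    then have "S \<subseteq> pverts G" by (auto simp: dominant_def)
    then show "k \<in> {..card (pverts G)}" using k(1) card_mono[OF assms(1)] by simp
  qed
  then have "finite ?M" by (rule finite_subset) simp
  moreover have "card S \<in> ?M" using assms(2-4) by blast
  ultimately show ?thesis unfolding f_chromatic_vertex_number_def by (rule Max_ge)
qed

theorem theorem2p3:
  fixes G :: "'a pair_pre_digraph" and d :: nat
  assumes "regular_graph G d"
    and "pverts G \<noteq> {}"
    and "d \<ge> 7"
    and "C4_free G"
  shows "int (f_chromatic_vertex_number G d) \<ge> \<lceil>(real d - 1) / 2\<rceil> + 2"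
proof -
  interpret pair_graph G using assms(1) by (simp add: regular_graph_def)
  define adj where "adj u w \<longleftrightarrow> (u, w) \<in> parcs G" for u w
  obtain v where v: "v \<in> pverts G" using assms(2) by blast
  have fin: "finite {w. adj u w}" for u
    by (rule finite_subset[OF _ pair_finite_verts]) (auto simp: adj_def dest: in_arcsD2)
  have deg: "card {w. adj u w} = d" if "u \<in> pverts G" for u
  proof -
    have "out_arcs (with_proj G) u = Pair u ` {w. adj u w}"
      by (auto simp: out_arcs_def adj_def)
    then have "card (out_arcs (with_proj G) u) = card {w. adj u w}"
      by (simp add: card_image inj_on_def)
    then show ?thesis
      using assms(1) that by (simp add: regular_graph_def Digraph.out_degree_def)
  qed
  obtain e where e: "bij_betw e {1..d} {w. adj v w}"
    using ex_bij_betw_nat_finite_1[OF fin[of v]] deg[OF v] by auto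
  have irrefl: "\<not> adj u u" for u
    using pair_no_loops[of "(u, u)"] by (auto simp: adj_def)
  interpret c4_free_rooted "pverts G" adj d v e
  proof
    show "w \<in> pverts G" if "adj u w" for u w using that in_arcsD2 by (simp add: adj_def)
    show "adj w u" if "adj u w" for u w
      using that pair_sym_arcs by (auto simp: adj_def symmetric_def dest: symD)
    show "a = b" if "adj u a" "adj u b" "adj w a" "adj w b" "u \<noteq> w" for u a b w
      using C4_free_common_neighbours[OF pair_graph_axioms assms(4), of u a b w] that
      by (simp add: adj_def)
  qed (use pair_finite_verts irrefl deg v e in auto)
  obtain I c where I: "I \<subseteq> {1..d}" "card I = Suc (d div 2)" and c: "fills I c"
    using fills_more_than_half assms(3) by auto
  obtain col where col: "\<And>u. u \<in> pverts G \<Longrightarrow> col u \<in> {1..d + 1}"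
    "\<And>u w. adj u w \<Longrightarrow> col u \<noteq> col w"
    "col v = d + 1" "\<And>i. i \<in> {1..d} \<Longrightarrow> col (e i) = i"
    "\<And>i \<gamma>. i \<in> I \<Longrightarrow> \<gamma> \<in> {1..d + 1} - {i} \<Longrightarrow> \<exists>u. adj (e i) u \<and> col u = \<gamma>"
    by (rule colouring_of_filled_petals[OF I(1) c]) (rule that; assumption)
  let ?S = "insert v (e ` I)"
  have v_notin: "v \<notin> e ` I"
  proof
    assume "v \<in> e ` I"
    then obtain i where "i \<in> I" "v = e i" by blast
    then show False using adj_e[of i] I(1) irrefl[of v] by auto
  qed
  have inj: "inj_on e I" using bij_betw_imp_inj_on[OF e] I(1) by (rule inj_on_subset)
  have "card ?S = d div 2 + 2"
    using v_notin card_image[OF inj] I(2) finite_subset[OF I(1)] by simp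
  moreover have "card ?S \<le> f_chromatic_vertex_number G d"
  proof (rule f_chromatic_vertex_number_ge[OF pair_finite_verts])
    show "proper_coloring G (d + 1) col"
      using col(1,2) by (auto simp: proper_coloring_def adj_def)
    have "dominant G (d + 1) col v"
    proof -
      have "adj v (e i) \<and> col (e i) = i" if "i \<in> {1..d + 1} - {d + 1}" for i
        using that adj_e[of i] col(4)[of i] by auto
      then show ?thesis using v col(3) unfolding dominant_def adj_def by metis
    qed
    moreover have "dominant G (d + 1) col (e i)" if "i \<in> I" for i
    proof -
      have i: "i \<in> {1..d}" using that I(1) by blast
      then show ?thesis
        using col(4)[OF i] col(5)[OF that] adj_V[OF adj_e[OF i]]
        unfolding dominant_def adj_def by metis
    qed
    ultimately show "?S \<subseteq> {v. dominant G (d + 1) col v}" by blast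
    show "inj_on col ?S"
    proof -
      have "col (e i) = i" "i \<noteq> d + 1" if "i \<in> I" for i
        using col(4)[of i] that I(1) by auto
      then show ?thesis using col(3) by (auto simp: inj_on_def)
    qed
  qed
  moreover have "\<lceil>(real d - 1) / 2\<rceil> \<le> int (d div 2)"
  proof (rule ceiling_le)
    have "real d \<le> real (Suc (2 * (d div 2)))" by (rule of_nat_mono) linarith
    then show "(real d - 1) / 2 \<le> of_int (int (d div 2))" by simp
  qed
  ultimately show ?thesis by linarith
qed

end
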